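(* Let $\mathcal{H}$ be a nonzero real Hilbert space, and let $K_1$ and $K_2$ be nonempty closed convex cones in $\mathcal{H}$. Suppose that $K_1$ is not a linear subspace. Assume that at least one of the following holds: (a) There exists $u\in\mathcal{H}$ such that $K_2=\{u\}^{\perp}$. (b) There exists $u\in\mathcal{H}$ such that $K_2\subseteq H:=\{u\}^{\perp}$ and $H\cap K_1=\{0\}$. (c) There is a finite-dimensional linear subspace $\mathcal{K}$ of $\mathcal{H}$ such that $K_1\subseteq\mathcal{K}$ or $K_2\subseteq\mathcal{K}$. Then the following hold: (i) If $K_1\cap K_2\neq\{0\}$, then $c_0(K_1,K_2)=1$; if $K_1\cap K_2=\{0\}$, then $c_0(K_1^{\ominus},K_2^{\oplus})=1$ and $c_0(K_1^{\oplus},K_2^{\ominus})=1$. (ii) If $c_0(K_1,K_2)<1$, then $c_0(K_1^{\ominus},K_2^{\oplus})=1$ and $c_0(K_1^{\oplus},K_2^{\ominus})=1$.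
   Context: A set $K\subseteq\mathcal{H}$ is a cone if $K=\mathbb{R}_{++}K$, where $\mathbb{R}_{++}=\{\lambda\in\mathbb{R}:\lambda>0\}$. $\mathbf{B}_{\mathcal{H}}=\{x\in\mathcal{H}:\|x\|\le 1\}$. For a nonempty set $A\subseteq\mathcal{H}$: the polar cone is $A^{\ominus}=\{u\in\mathcal{H}: \langle x,u\rangle\le 0\ \text{for all } x\in A\}$, the dual cone is $A^{\oplus}=-A^{\ominus}$, and $A^{\perp}=\{u\in\mathcal{H}:\langle x,u\rangle=0\ \text{for all } x\in A\}$. For nonempty closed convex cones $K_1,K_2$, the cosine of the minimal angle between them is $$c_0(K_1,K_2):=\sup\{\langle x,y\rangle : x\in K_1\cap\mathbf{B}_{\mathcal{H}},\ y\in K_2\cap\mathbf{B}_{\mathcal{H}}\}.$$ *)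

theory Defs
  imports "HOL-Analysis.Analysis"
begin

(* K = R_{++} K. This differs from the library predicates cone and conic, which scale by all
   c >= 0: a strict cone need not contain 0 (a nonempty closed one does). *)
definition strict_cone :: "'a::real_vector set \<Rightarrow> bool" where
  "strict_cone K \<longleftrightarrow> K = {c *\<^sub>R x | c x. c > 0 \<and> x \<in> K}"

definition polar_cone :: "'a::real_inner set \<Rightarrow> 'a set" where
  "polar_cone A = {u. \<forall>x\<in>A. x \<bullet> u \<le> 0}"

definition dual_cone :: "'a::real_inner set \<Rightarrow> 'a set" where
  "dual_cone A = uminus ` polar_cone A"

(* The supremum is taken in the reals. For nonempty closed cones the set contains 0 and is
   bounded above by 1, so Sup is the actual least upper bound. *)
definition cos_min_angle :: "'a::real_inner set \<Rightarrow> 'a set \<Rightarrow> real" where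
  "cos_min_angle K1 K2 =
     Sup {x \<bullet> y | x y. x \<in> K1 \<inter> cball 0 1 \<and> y \<in> K2 \<inter> cball 0 1}"

definition finite_dim_subspace :: "'a::real_vector set \<Rightarrow> bool" where
  "finite_dim_subspace V \<longleftrightarrow> subspace V \<and> (\<exists>B. finite B \<and> span B = V)"

end

theory Submission
  imports Defs
begin

text \<open>
  If \<open>K1 \<inter> K2 = {0}\<close>, it suffices to find a nonzero \<open>w\<close> that is nonpositive on \<open>K1\<close> and
  nonnegative on \<open>K2\<close>, since \<open>w\<close> is then common to the polar cone of \<open>K1\<close> and the dual cone
  of \<open>K2\<close>. In cases (a) and (b), \<open>K1\<close> must lie on one side of the hyperplane orthogonal to \<open>u\<close>,
  because a cone that meets the hyperplane only in \<open>0\<close> and reaches both sides of it is a line; so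
  \<open>w = \<plusminus>u\<close> works. In case (c), compactness of bounded closed sets in finite dimension makes
  \<open>K1 - K2\<close> closed. It is a proper subset: if \<open>x \<in> K1\<close> and \<open>-x \<notin> K1\<close>, then \<open>-x = a - b\<close> would give
  \<open>b = a + x \<in> K1 \<inter> K2 = {0}\<close>, hence \<open>a = -x\<close>. Projecting \<open>-x\<close> onto \<open>K1 - K2\<close> yields \<open>w\<close>.
\<close>

section \<open>Separation from a closed convex cone in a Hilbert space\<close>

text \<open>The parallelogram law for \<open>z - x\<close> and \<open>z - y\<close>. Two points of a
  convex set that are almost nearest to \<open>z\<close> are close together, because their midpoint
  cannot be much nearer.\<close>

lemma parallelogram_midpoint:
  fixes x y z :: "'a::real_inner"
  shows "(dist x y)\<^sup>2 = 2 * (dist z x)\<^sup>2 + 2 * (dist z y)\<^sup>2 - 4 * (dist z (midpoint x y))\<^sup>2"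
  by (simp add: dist_norm power2_norm_eq_inner midpoint_def inner_simps inner_commute algebra_simps)

text \<open>Completeness takes the place of local compactness: a minimizing sequence is Cauchy, and
  its limit stays in the closed set.\<close>

lemma nearest_point_exists:
  fixes S :: "'a::{real_inner, complete_space} set"
  assumes "closed S" "convex S" "S \<noteq> {}"
  obtains p where "p \<in> S" "\<And>s. s \<in> S \<Longrightarrow> dist z p \<le> dist z s"
proof -
  define d where "d = infdist z S"
  have d_le: "d \<le> dist z s" if "s \<in> S" for s
    unfolding d_def using that by (rule infdist_le)
  have d0: "d \<ge> 0"
    unfolding d_def by (rule infdist_nonneg)
  have "\<exists>s\<in>S. dist z s < d + e" if "e > 0" for e
  proof -
    have "(INF s\<in>S. dist z s) < d + e"
      using that assms(3) by (simp add: d_def infdist_notempty)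
    then show ?thesis
      using assms(3) by (subst (asm) cINF_less_iff) auto
  qed
  then have "\<forall>n. \<exists>s. s \<in> S \<and> dist z s < d + 1 / real (Suc n)"
    by (meson of_nat_0_less_iff zero_less_Suc zero_less_divide_1_iff)
  then obtain s where s: "\<And>n. s n \<in> S" "\<And>n. dist z (s n) < d + 1 / real (Suc n)"
    by metis
  have "Cauchy s"
  proof (rule metric_CauchyI)
    fix e :: real
    assume e: "e > 0"
    \<comment> \<open>The midpoint identity bounds the squared distance of two points of
      \<open>S\<close> within \<open>h\<close> of \<open>z\<close> by
      \<open>4 * (h\<^sup>2 - d\<^sup>2)\<close>, which tends to 0 as \<open>h\<close> tends to
      \<open>d\<close>.\<close>
    have "(\<lambda>n. 4 * ((d + 1 / real (Suc n))\<^sup>2 - d\<^sup>2)) \<longlonglongrightarrow> 4 * ((d + 0)\<^sup>2 - d\<^sup>2)"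
      by (intro tendsto_intros LIMSEQ_Suc[OF lim_1_over_n])
    then have "\<forall>\<^sub>F n in sequentially. 4 * ((d + 1 / real (Suc n))\<^sup>2 - d\<^sup>2) < e\<^sup>2"
      using e by (auto intro: order_tendstoD(2))
    then obtain N where N: "4 * ((d + 1 / real (Suc N))\<^sup>2 - d\<^sup>2) < e\<^sup>2"
      by (auto simp: eventually_sequentially)
    define h where "h = d + 1 / real (Suc N)"
    have h: "4 * (h\<^sup>2 - d\<^sup>2) < e\<^sup>2"
      using N by (simp only: h_def)
    have near: "(dist z (s n))\<^sup>2 \<le> h\<^sup>2" if "n \<ge> N" for n
    proof (rule power_mono)
      have "1 / real (Suc n) \<le> 1 / real (Suc N)"
        using that by (intro divide_left_mono) auto
      then show "dist z (s n) \<le> h"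
        using s(2)[of n] unfolding h_def by linarith
    qed simp
    have "dist (s m) (s n) < e" if "m \<ge> N" "n \<ge> N" for m n
    proof -
      have "midpoint (s m) (s n) \<in> S"
        using convexD[OF assms(2) s(1)[of m] s(1)[of n], of "1/2" "1/2"]
        by (simp add: midpoint_def scaleR_add_right)
      then have "d\<^sup>2 \<le> (dist z (midpoint (s m) (s n)))\<^sup>2"
        using d_le d0 by (intro power_mono)
      then have "(dist (s m) (s n))\<^sup>2 \<le> 2 * h\<^sup>2 + 2 * h\<^sup>2 - 4 * d\<^sup>2"
        unfolding parallelogram_midpoint[of "s m" "s n" z]
        by (intro diff_mono add_mono mult_left_mono near that) auto
      then have "(dist (s m) (s n))\<^sup>2 < e\<^sup>2"
        using h by simp
      then show ?thesis
        using e by (simp add: power_less_imp_less_base)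
    qed
    then show "\<exists>N. \<forall>m\<ge>N. \<forall>n\<ge>N. dist (s m) (s n) < e"
      by blast
  qed
  then obtain p where p: "s \<longlonglongrightarrow> p"
    using Cauchy_convergent convergent_def by blast
  show thesis
  proof
    show "p \<in> S"
      using closed_sequentially[OF assms(1) s(1) p] .
    have "(\<lambda>n. d + 1 / real (Suc n)) \<longlonglongrightarrow> d + 0"
      by (intro tendsto_intros LIMSEQ_Suc[OF lim_1_over_n])
    moreover have "(\<lambda>n. dist z (s n)) \<longlonglongrightarrow> dist z p"
      using p by (intro tendsto_intros)
    ultimately have "dist z p \<le> d"
      using s(2) by (intro LIMSEQ_le[of "\<lambda>n. dist z (s n)" _ "\<lambda>n. d + 1 / real (Suc n)"])
        (auto intro: less_imp_le)
    then show "dist z p \<le> dist z t" if "t \<in> S" for t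
      using d_le[OF that] by linarith
  qed
qed

text \<open>Take \<open>w = z - p\<close> with \<open>p\<close> nearest to \<open>z\<close>. For
  \<open>t\<close> in \<open>S\<close> also \<open>p + t\<close> is in \<open>S\<close>, so if
  \<open>w\<close> had a positive product with \<open>t\<close>, a small move from \<open>p\<close>
  along \<open>t\<close> would stay in \<open>S\<close> and come closer to \<open>z\<close>.\<close>

lemma separate_point_closed_cone:
  fixes S :: "'a::{real_inner, complete_space} set"
  assumes "closed S" "convex S" "S \<noteq> {}" "z \<notin> S"
    and add: "\<And>x y. x \<in> S \<Longrightarrow> y \<in> S \<Longrightarrow> x + y \<in> S"
  obtains w where "w \<noteq> 0" "\<And>s. s \<in> S \<Longrightarrow> w \<bullet> s \<le> 0"
proof -
  obtain p where p: "p \<in> S" "\<And>s. s \<in> S \<Longrightarrow> dist z p \<le> dist z s"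
    using nearest_point_exists assms(1-3) by metis
  show thesis
  proof
    show "z - p \<noteq> 0"
      using p(1) assms(4) by auto
    fix t
    assume "t \<in> S"
    show "(z - p) \<bullet> t \<le> 0"
    proof (rule ccontr)
      assume "\<not> (z - p) \<bullet> t \<le> 0"
      then have "(z - p) \<bullet> (p + t - p) > 0"
        by simp
      then obtain u where u: "0 < u" "u \<le> 1" "dist (p + u *\<^sub>R (p + t - p)) z < dist p z"
        by (rule closer_point_lemma[THEN exE]) blast
      have "p + u *\<^sub>R t = (1 - u) *\<^sub>R p + u *\<^sub>R (p + t)"
        by (simp add: algebra_simps)
      also have "\<dots> \<in> S"
        using u p(1) add[OF p(1) \<open>t \<in> S\<close>] by (intro convexD[OF assms(2)]) auto
      finally show False
        using p(2) u(3) by (fastforce simp: dist_commute)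
    qed
  qed
qed

section \<open>Compactness in finite-dimensional subspaces\<close>

text \<open>The ambient space may be infinite-dimensional, so compactness is built up from segments:
  each induction step adds the compact segment of multiples of one vector.\<close>

lemma compact_bounded_combinations:
  fixes C :: "'a::real_normed_vector set"
  assumes "finite C"
  shows "compact {\<Sum>c\<in>C. t c *\<^sub>R c | t. \<forall>c\<in>C. \<bar>t c\<bar> \<le> M c}"
  using assms
proof induction
  case empty
  then show ?case by simp
next
  case (insert a C)
  let ?Q = "{\<Sum>c\<in>C. t c *\<^sub>R c | t. \<forall>c\<in>C. \<bar>t c\<bar> \<le> M c}"
  have "compact ((\<lambda>r. r *\<^sub>R a) ` {- M a..M a})"
    by (intro compact_continuous_image continuous_intros) auto
  then have "compact {x + y | x y. x \<in> (\<lambda>r. r *\<^sub>R a) ` {- M a..M a} \<and> y \<in> ?Q}"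
    using insert.IH by (rule compact_sums)
  also have "{x + y | x y. x \<in> (\<lambda>r. r *\<^sub>R a) ` {- M a..M a} \<and> y \<in> ?Q} =
    {\<Sum>c\<in>insert a C. t c *\<^sub>R c | t. \<forall>c\<in>insert a C. \<bar>t c\<bar> \<le> M c}" (is "?L = ?R")
  proof (intro subset_antisym subsetI)
    fix v
    assume "v \<in> ?L"
    then obtain r t where v: "v = r *\<^sub>R a + (\<Sum>c\<in>C. t c *\<^sub>R c)" "\<bar>r\<bar> \<le> M a" "\<forall>c\<in>C. \<bar>t c\<bar> \<le> M c"
      by auto
    \<comment> \<open>Since \<open>a\<close> is not in \<open>C\<close>, overriding the coefficient
      at \<open>a\<close> leaves this sum unchanged.\<close>
    have "(\<Sum>c\<in>C. (t(a := r)) c *\<^sub>R c) = (\<Sum>c\<in>C. t c *\<^sub>R c)"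
      using insert.hyps by (intro sum.cong) auto
    then have "v = (\<Sum>c\<in>insert a C. (t(a := r)) c *\<^sub>R c)"
      using insert.hyps v(1) by simp
    moreover have "\<forall>c\<in>insert a C. \<bar>(t(a := r)) c\<bar> \<le> M c"
      using v by simp
    ultimately show "v \<in> ?R"
      by blast
  next
    fix v
    assume "v \<in> ?R"
    then obtain t where t: "v = (\<Sum>c\<in>insert a C. t c *\<^sub>R c)" "\<forall>c\<in>insert a C. \<bar>t c\<bar> \<le> M c"
      by blast
    then have "v = t a *\<^sub>R a + (\<Sum>c\<in>C. t c *\<^sub>R c)" "t a \<in> {- M a..M a}"
      using insert.hyps by auto
    then show "v \<in> ?L"
      using t(2) by blast
  qed
  finally show ?case .
qed

text \<open>The remainder lies in the span and is orthogonal to \<open>C\<close>, hence to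
  itself.\<close>

lemma orthogonal_expansion:
  fixes C :: "'a::real_inner set"
  assumes "finite C" "pairwise orthogonal C" "x \<in> span C"
  shows "x = (\<Sum>c\<in>C. ((x \<bullet> c) / (c \<bullet> c)) *\<^sub>R c)"
proof -
  let ?y = "\<Sum>c\<in>C. ((x \<bullet> c) / (c \<bullet> c)) *\<^sub>R c"
  have "?y \<in> span C"
    by (intro span_sum span_scale span_base)
  with assms(3) have "x - ?y \<in> span C"
    by (rule span_diff)
  moreover have "orthogonal (x - ?y) c" if c: "c \<in> C" for c
  proof -
    \<comment> \<open>\<open>C\<close> may contain 0; then division by zero gives coefficient 0,
      which agrees with \<open>x \<bullet> 0 = 0\<close>.\<close>
    have "?y \<bullet> c = (\<Sum>b\<in>C. if b = c then x \<bullet> c else 0)"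
      unfolding inner_sum_left
      using assms(2) c by (intro sum.cong) (auto simp: pairwise_def orthogonal_def)
    also have "\<dots> = x \<bullet> c"
      using assms(1) c by simp
    finally show ?thesis
      by (simp add: orthogonal_def inner_diff_left)
  qed
  ultimately have "orthogonal (x - ?y) (x - ?y)"
    by (rule orthogonal_to_span)
  then show ?thesis
    by (simp add: orthogonal_def)
qed

text \<open>By Cauchy-Schwarz the coefficients with respect to an orthogonal spanning set are
  bounded on \<open>S\<close>, so \<open>S\<close> is a closed subset of a compact set of bounded
  combinations.\<close>

lemma compact_closed_bounded_in_span:
  fixes S :: "'a::real_inner set"
  assumes "finite B" "S \<subseteq> span B" "closed S" "bounded S"
  shows "compact S"
proof -
  obtain C where C: "finite C" "span C = span B" "pairwise orthogonal C"
    using basis_orthogonal[OF assms(1)] by blast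
  obtain R where R: "\<And>x. x \<in> S \<Longrightarrow> norm x \<le> R"
    using assms(4) bounded_iff by blast
  let ?Q = "{\<Sum>c\<in>C. t c *\<^sub>R c | t. \<forall>c\<in>C. \<bar>t c\<bar> \<le> R * norm c / (c \<bullet> c)}"
  have "S \<subseteq> ?Q"
  proof
    fix x
    assume x: "x \<in> S"
    then have "x = (\<Sum>c\<in>C. ((x \<bullet> c) / (c \<bullet> c)) *\<^sub>R c)"
      using C assms(2) by (intro orthogonal_expansion) auto
    moreover have "\<bar>(x \<bullet> c) / (c \<bullet> c)\<bar> \<le> R * norm c / (c \<bullet> c)" for c
    proof -
      have "\<bar>x \<bullet> c\<bar> \<le> R * norm c"
        using Cauchy_Schwarz_ineq2[of x c] R[OF x] mult_right_mono[of "norm x" R "norm c"] by simp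
      then show ?thesis
        by (simp add: divide_right_mono)
    qed
    ultimately show "x \<in> ?Q"
      by (intro CollectI exI[of _ "\<lambda>c. (x \<bullet> c) / (c \<bullet> c)"]) simp
  qed
  moreover have "compact ?Q"
    using C(1) by (rule compact_bounded_combinations)
  ultimately show ?thesis
    using compact_Int_closed[of ?Q S] assms(3) by (simp add: Int_absorb1)
qed

section \<open>Closed convex cones\<close>

lemma strict_cone_scale: "strict_cone K \<Longrightarrow> x \<in> K \<Longrightarrow> c > 0 \<Longrightarrow> c *\<^sub>R x \<in> K"
  unfolding strict_cone_def by blast

text \<open>Only positive scalars are available, so 0 is reached as the limit of shrinking multiples
  of a point of \<open>K\<close>.\<close>

lemma closed_strict_cone_zero:
  fixes K :: "'a::real_normed_vector set"
  assumes "K \<noteq> {}" "closed K" "strict_cone K"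
  shows "0 \<in> K"
proof -
  obtain x where x: "x \<in> K"
    using assms(1) by blast
  have "(\<lambda>n. (1 / real (Suc n)) *\<^sub>R x) \<longlonglongrightarrow> 0 *\<^sub>R x"
    by (intro tendsto_intros LIMSEQ_Suc[OF lim_1_over_n])
  moreover have "(1 / real (Suc n)) *\<^sub>R x \<in> K" for n
    by (rule strict_cone_scale[OF assms(3) x]) simp
  ultimately show ?thesis
    using closed_sequentially[OF assms(2)] by fastforce
qed

text \<open>The sum is twice the midpoint.\<close>

lemma convex_strict_cone_add:
  assumes "convex K" "strict_cone K" "x \<in> K" "y \<in> K"
  shows "x + y \<in> K"
proof -
  have "(1/2) *\<^sub>R x + (1/2) *\<^sub>R y \<in> K"
    using assms by (intro convexD) auto
  then have "2 *\<^sub>R ((1/2) *\<^sub>R x + (1/2) *\<^sub>R y) \<in> K"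
    using assms(2) by (intro strict_cone_scale) auto
  then show ?thesis
    by (simp add: scaleR_add_right)
qed

lemma convex_cone_subspaceI:
  assumes "convex K" "strict_cone K" "0 \<in> K" "\<And>x. x \<in> K \<Longrightarrow> - x \<in> K"
  shows "subspace K"
proof (rule subspaceI)
  fix c :: real and x
  assume x: "x \<in> K"
  consider "c > 0" | "c = 0" | "c < 0"
    by linarith
  then show "c *\<^sub>R x \<in> K"
  proof cases
    case 3
    then show ?thesis
      using strict_cone_scale[OF assms(2) assms(4)[OF x], of "- c"] by simp
  qed (use assms x strict_cone_scale in auto)
qed (use assms convex_strict_cone_add in auto)

text \<open>If points lie strictly on both sides, every \<open>x\<close> in \<open>K\<close> off the
  hyperplane has a partner \<open>y\<close> across it. Some \<open>x + r *\<^sub>R y\<close> with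
  \<open>r > 0\<close> lies on the hyperplane, hence is 0, so \<open>- x\<close> is in
  \<open>K\<close>. Then \<open>K\<close> would be a subspace.\<close>

lemma cone_one_side_of_hyperplane:
  assumes "convex K" "strict_cone K" "0 \<in> K" "\<not> subspace K"
    and meet: "\<And>x. x \<in> K \<Longrightarrow> x \<bullet> u = 0 \<Longrightarrow> x = 0"
  shows "(\<forall>x\<in>K. x \<bullet> u \<le> 0) \<or> (\<forall>x\<in>K. x \<bullet> u \<ge> 0)"
proof (rule ccontr)
  assume "\<not> ?thesis"
  then obtain p q where pq: "p \<in> K" "p \<bullet> u > 0" "q \<in> K" "q \<bullet> u < 0"
    by (auto simp: not_le)
  have opp: "- x \<in> K" if "x \<in> K" "y \<in> K" "(x \<bullet> u) * (y \<bullet> u) < 0" for x y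
  proof -
    \<comment> \<open>The unique \<open>r\<close> that makes \<open>x + r *\<^sub>R y\<close>
      orthogonal to \<open>u\<close>; it is positive because the two products have opposite
      signs.\<close>
    define r where "r = - (x \<bullet> u) / (y \<bullet> u)"
    have r: "r > 0" "y \<bullet> u \<noteq> 0"
      using that(3) by (auto simp: r_def mult_less_0_iff zero_less_divide_iff divide_less_0_iff)
    have ry: "r *\<^sub>R y \<in> K"
      using strict_cone_scale assms(2) that(2) r(1) by blast
    have "x + r *\<^sub>R y = 0"
      using r by (intro meet convex_strict_cone_add that ry assms) (simp add: r_def inner_simps)
    then show ?thesis
      using ry by (simp add: add_eq_0_iff)
  qed
  have "- x \<in> K" if x: "x \<in> K" for x
  proof -
    consider "x \<bullet> u = 0" | "x \<bullet> u > 0" | "x \<bullet> u < 0"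
      by linarith
    then show ?thesis
    proof cases
      case 1
      then show ?thesis
        using meet[OF x] assms(3) by simp
    next
      case 2
      then show ?thesis
        using opp[OF x pq(3)] pq by (simp add: mult_less_0_iff)
    next
      case 3
      then show ?thesis
        using opp[OF x pq(1)] pq by (simp add: mult_less_0_iff)
    qed
  qed
  then show False
    using convex_cone_subspaceI assms by blast
qed

section \<open>Closedness of the difference of two cones, and their separation\<close>

text \<open>The unit vectors of \<open>K1\<close> form a compact set at positive distance \<delta>
  from \<open>K2\<close>. By homogeneity \<open>\<delta> * norm a \<le> norm (a - b)\<close>, so
  bounded differences come from bounded \<open>a\<close>, and a compact set minus a closed set is
  closed.\<close>

lemma closed_cone_differences:
  fixes K1 K2 :: "'a::real_inner set"
  assumes K1: "closed K1" "strict_cone K1" and K2: "closed K2" "strict_cone K2"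
    and inter: "K1 \<inter> K2 \<subseteq> {0}"
    and B: "finite B" "K1 \<subseteq> span B"
  shows "closed {a - b | a b. a \<in> K1 \<and> b \<in> K2}"
proof -
  have diff: "{x - y | x y. x \<in> A \<and> y \<in> T} = (\<Union>x\<in>A. \<Union>y\<in>T. {x - y})" for A T :: "'a set"
    by blast
  let ?D = "{a - b | a b. a \<in> K1 \<inter> sphere 0 1 \<and> b \<in> K2}"
  have "closed ?D"
  proof -
    have "closed (sphere (0::'a) 1)"
      unfolding sphere_def by (intro closed_Collect_eq continuous_intros)
    moreover have "bounded (sphere (0::'a) 1)"
      using bounded_cball sphere_cball by (rule bounded_subset)
    ultimately have "compact (K1 \<inter> sphere 0 1)"
      using B K1(1) by (intro compact_closed_bounded_in_span[of B]) (auto intro: closed_Int bounded_Int)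
    then show ?thesis
      unfolding diff using K2(1) by (rule compact_closed_differences)
  qed
  \<comment> \<open>Otherwise a unit vector would lie in both cones.\<close>
  moreover have "0 \<notin> ?D"
    using inter by auto
  ultimately have "open (- ?D)" "0 \<in> - ?D"
    by (simp_all only: open_Compl Compl_iff not_False_eq_True)
  then obtain \<delta> where \<delta>: "\<delta> > 0" and sub: "ball 0 \<delta> \<subseteq> - ?D"
    by (rule openE)
  have far: "\<delta> \<le> norm v" if v: "v \<in> ?D" for v
  proof (rule ccontr)
    assume "\<not> \<delta> \<le> norm v"
    then have "v \<in> - ?D"
      by (intro subsetD[OF sub]) simp
    then show False
      using v by (rule ComplD[THEN notE])
  qed
  have bound: "\<delta> * norm a \<le> norm (a - b)" if a: "a \<in> K1" and b: "b \<in> K2" for a b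
  proof (cases "a = 0")
    case False
    let ?c = "1 / norm a"
    \<comment> \<open>Scaling both points by \<open>1 / norm a\<close> moves \<open>a\<close> to the
      unit sphere, where the distance bound applies.\<close>
    have "?c *\<^sub>R a \<in> K1" "?c *\<^sub>R b \<in> K2"
      using False a b K1 K2 by (auto intro!: strict_cone_scale simp del: scaleR_eq_0_iff)
    then have "?c *\<^sub>R a - ?c *\<^sub>R b \<in> ?D"
      using False by (intro CollectI exI[of _ "?c *\<^sub>R a"] exI[of _ "?c *\<^sub>R b"]) simp
    then have "\<delta> \<le> norm (?c *\<^sub>R a - ?c *\<^sub>R b)"
      by (rule far)
    also have "\<dots> = norm (a - b) / norm a"
      by (simp flip: scaleR_diff_right)
    finally show ?thesis
      using False by (simp add: field_simps)
  qed simp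
  show ?thesis
    unfolding closed_sequential_limits
  proof (intro allI impI, elim conjE)
    fix z l
    assume z: "\<forall>n. z n \<in> {a - b | a b. a \<in> K1 \<and> b \<in> K2}" and lim: "z \<longlonglongrightarrow> l"
    obtain M where M: "\<And>n. norm (z n) \<le> M"
      using convergent_imp_bounded[OF lim] by (auto simp: bounded_iff)
    \<comment> \<open>The bound places the whole sequence, through its \<open>K1\<close> components,
      in this smaller closed set, which therefore contains the limit.\<close>
    let ?E = "{a - b | a b. a \<in> K1 \<inter> cball 0 (M / \<delta>) \<and> b \<in> K2}"
    have "z n \<in> ?E" for n
    proof -
      obtain a b where ab: "z n = a - b" "a \<in> K1" "b \<in> K2"
        using z by blast
      have "\<delta> * norm a \<le> M"
        using bound[OF ab(2,3)] M[of n] unfolding ab(1) by linarith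
      then have "norm a \<le> M / \<delta>"
        using \<delta> by (simp add: pos_le_divide_eq mult.commute)
      then show ?thesis
        using ab by auto
    qed
    moreover have "closed ?E"
    proof -
      have "compact (K1 \<inter> cball 0 (M / \<delta>))"
        using B K1(1) by (intro compact_closed_bounded_in_span[of B] closed_Int bounded_Int) auto
      then show ?thesis
        unfolding diff using K2(1) by (rule compact_closed_differences)
    qed
    ultimately have "l \<in> ?E"
      using closed_sequentially lim by blast
    then show "l \<in> {a - b | a b. a \<in> K1 \<and> b \<in> K2}"
      by blast
  qed
qed

text \<open>If \<open>K2\<close> is the finite-dimensional one, the roles are exchanged:
  \<open>K1 - K2\<close> is the negative of \<open>K2 - K1\<close>.\<close>

lemma closed_cone_differences_finite_dim:
  fixes K1 K2 :: "'a::real_inner set"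
  assumes K1: "closed K1" "strict_cone K1" and K2: "closed K2" "strict_cone K2"
    and inter: "K1 \<inter> K2 \<subseteq> {0}"
    and V: "finite_dim_subspace V" "K1 \<subseteq> V \<or> K2 \<subseteq> V"
  shows "closed {a - b | a b. a \<in> K1 \<and> b \<in> K2}"
proof -
  obtain B where B: "finite B" "span B = V"
    using V(1) unfolding finite_dim_subspace_def by blast
  show ?thesis
    using V(2)
  proof
    assume "K1 \<subseteq> V"
    then show ?thesis
      using closed_cone_differences[OF K1 K2 inter B(1)] B(2) by blast
  next
    assume "K2 \<subseteq> V"
    then have "closed {b - a | b a. b \<in> K2 \<and> a \<in> K1}"
      using inter B by (intro closed_cone_differences[OF K2 K1 _ B(1)]) auto
    then have "closed (uminus ` {b - a | b a. b \<in> K2 \<and> a \<in> K1})"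
      by (rule closed_negations)
    also have "uminus ` {b - a | b a. b \<in> K2 \<and> a \<in> K1} = {a - b | a b. a \<in> K1 \<and> b \<in> K2}"
      by (force simp: image_iff)
    finally show ?thesis .
  qed
qed

text \<open>A vector nonpositive on all differences \<open>a - b\<close> has the required signs:
  \<open>b = 0\<close> gives the one on \<open>K1\<close>, and \<open>a = 0\<close> the one on
  \<open>K2\<close>.\<close>

lemma separate_cones_closed_difference:
  fixes K1 K2 :: "'a::{real_inner, complete_space} set"
  assumes K1: "convex K1" "strict_cone K1" "0 \<in> K1" "\<not> subspace K1"
    and K2: "convex K2" "strict_cone K2" "0 \<in> K2"
    and inter: "K1 \<inter> K2 \<subseteq> {0}"
    and closed: "closed {a - b | a b. a \<in> K1 \<and> b \<in> K2}"
  obtains w where "w \<noteq> 0" "\<And>x. x \<in> K1 \<Longrightarrow> x \<bullet> w \<le> 0" "\<And>y. y \<in> K2 \<Longrightarrow> y \<bullet> w \<ge> 0"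
proof -
  let ?D = "{a - b | a b. a \<in> K1 \<and> b \<in> K2}"
  obtain x where x: "x \<in> K1" "- x \<notin> K1"
    using convex_cone_subspaceI K1 by blast
  have notin: "- x \<notin> ?D"
  proof
    assume "- x \<in> ?D"
    then obtain a b where ab: "- x = a - b" "a \<in> K1" "b \<in> K2"
      by blast
    have b: "b = a + x"
      using ab(1) by (simp add: algebra_simps)
    then have "b \<in> K1"
      using convex_strict_cone_add K1 ab(2) x(1) by blast
    then have "a + x = 0"
      using inter ab(3) b by blast
    then show False
      using ab(2) x(2) by (simp add: eq_neg_iff_add_eq_0[symmetric])
  qed
  have ne: "?D \<noteq> {}"
    using K1(3) K2(3) by blast
  have conv: "convex ?D"
    using convex_differences[OF K1(1) K2(1)] by (rule back_subst[of convex]) blast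
  have add: "u + v \<in> ?D" if "u \<in> ?D" "v \<in> ?D" for u v
  proof -
    obtain a b c d where *: "u = a - b" "v = c - d" "a \<in> K1" "c \<in> K1" "b \<in> K2" "d \<in> K2"
      using \<open>u \<in> ?D\<close> \<open>v \<in> ?D\<close> by blast
    then have "a + c \<in> K1" "b + d \<in> K2" "u + v = (a + c) - (b + d)"
      using convex_strict_cone_add K1 K2 by (auto simp: algebra_simps)
    then show ?thesis
      by blast
  qed
  show thesis
  proof (rule separate_point_closed_cone[OF closed conv ne notin add])
    fix w
    assume w: "w \<noteq> 0" "\<And>s. s \<in> ?D \<Longrightarrow> w \<bullet> s \<le> 0"
    show thesis
    proof (rule that[of w])
      show "y \<bullet> w \<le> 0" if "y \<in> K1" for y
      proof -
        have "y - 0 \<in> ?D"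
          using that K2(3) by blast
        then show ?thesis
          using w(2)[of "y - 0"] by (simp add: inner_commute)
      qed
      show "y \<bullet> w \<ge> 0" if "y \<in> K2" for y
      proof -
        have "0 - y \<in> ?D"
          using that K1(3) by blast
        then show ?thesis
          using w(2)[of "0 - y"] by (simp add: inner_commute)
      qed
    qed (rule w(1))
  qed
qed

section \<open>The cosine of the minimal angle\<close>

text \<open>The unit vector along \<open>w\<close>, used in both places, attains the Cauchy-Schwarz
  bound 1. Only the ray through \<open>w\<close> has to lie in both sets, so the lemma serves the
  given cones and their polar and dual cones alike.\<close>

lemma cos_min_angle_eq_1:
  assumes w: "w \<in> K1" "w \<in> K2" "w \<noteq> 0"
    and cone: "\<And>c. c > 0 \<Longrightarrow> c *\<^sub>R w \<in> K1" "\<And>c. c > 0 \<Longrightarrow> c *\<^sub>R w \<in> K2"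
  shows "cos_min_angle K1 K2 = 1"
  unfolding cos_min_angle_def
proof (rule cSup_eq_maximum)
  have "sgn w \<in> K1" "sgn w \<in> K2"
    using cone[of "inverse (norm w)"] w(3) by (auto simp: sgn_div_norm)
  moreover have "sgn w \<bullet> sgn w = 1" "norm (sgn w) = 1"
    using w(3) by (simp_all add: norm_sgn flip: power2_norm_eq_inner)
  ultimately show "1 \<in> {x \<bullet> y | x y. x \<in> K1 \<inter> cball 0 1 \<and> y \<in> K2 \<inter> cball 0 1}"
    by (force intro!: exI[of _ "sgn w"])
next
  fix t
  assume "t \<in> {x \<bullet> y | x y. x \<in> K1 \<inter> cball 0 1 \<and> y \<in> K2 \<inter> cball 0 1}"
  then obtain x y where "t = x \<bullet> y" "x \<in> K1 \<inter> cball 0 1" "y \<in> K2 \<inter> cball 0 1"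
    by blast
  then have xy: "t = x \<bullet> y" "norm x \<le> 1" "norm y \<le> 1"
    by simp_all
  have "x \<bullet> y \<le> norm x * norm y"
    by (rule norm_cauchy_schwarz)
  also have "\<dots> \<le> 1"
    using xy mult_mono[of "norm x" 1 "norm y" 1] by simp
  finally show "t \<le> 1"
    using xy(1) by simp
qed

section \<open>Polar and dual cones, and the separating vector\<close>

lemma polar_cone_iff: "u \<in> polar_cone A \<longleftrightarrow> (\<forall>x\<in>A. x \<bullet> u \<le> 0)"
  by (simp add: polar_cone_def)

lemma dual_cone_iff: "u \<in> dual_cone A \<longleftrightarrow> (\<forall>x\<in>A. x \<bullet> u \<ge> 0)"
proof -
  have "u \<in> dual_cone A \<longleftrightarrow> - u \<in> polar_cone A"
    unfolding dual_cone_def by (auto intro: image_eqI[of _ _ "- u"])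
  then show ?thesis
    by (simp add: polar_cone_iff)
qed

text \<open>One vector gives both equalities: \<open>w\<close> is common to the first pair of cones
  and \<open>- w\<close> to the second.\<close>

lemma cos_min_angle_polar_dual:
  assumes "w \<noteq> 0" "\<And>x. x \<in> K1 \<Longrightarrow> x \<bullet> w \<le> 0" "\<And>y. y \<in> K2 \<Longrightarrow> y \<bullet> w \<ge> 0"
  shows "cos_min_angle (polar_cone K1) (dual_cone K2) = 1"
    and "cos_min_angle (dual_cone K1) (polar_cone K2) = 1"
proof -
  have w: "w \<in> polar_cone K1" "w \<in> dual_cone K2" "- w \<in> dual_cone K1" "- w \<in> polar_cone K2"
    using assms(2,3) by (simp_all add: polar_cone_iff dual_cone_iff)
  show "cos_min_angle (polar_cone K1) (dual_cone K2) = 1"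
    using w(1,2) assms(1)
    by (intro cos_min_angle_eq_1[of w]) (simp_all add: polar_cone_iff dual_cone_iff mult_nonneg_nonpos)
  show "cos_min_angle (dual_cone K1) (polar_cone K2) = 1"
    using w(3,4) assms(1)
    by (intro cos_min_angle_eq_1[of "- w"]) (simp_all add: polar_cone_iff dual_cone_iff mult_nonneg_nonpos)
qed

lemma separating_vector_exists:
  fixes K1 K2 :: "'a::{real_inner, complete_space} set"
  assumes K1: "closed K1" "convex K1" "strict_cone K1" "0 \<in> K1" "\<not> subspace K1"
    and K2: "closed K2" "convex K2" "strict_cone K2" "0 \<in> K2"
    and inter: "K1 \<inter> K2 = {0}"
    and abc:
      "(\<exists>u. K2 = orthogonal_comp {u})
       \<or> (\<exists>u. K2 \<subseteq> orthogonal_comp {u} \<and> orthogonal_comp {u} \<inter> K1 = {0})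
       \<or> (\<exists>V. finite_dim_subspace V \<and> (K1 \<subseteq> V \<or> K2 \<subseteq> V))"
  obtains w where "w \<noteq> 0" "\<And>x. x \<in> K1 \<Longrightarrow> x \<bullet> w \<le> 0" "\<And>y. y \<in> K2 \<Longrightarrow> y \<bullet> w \<ge> 0"
proof -
  have perp: "x \<in> orthogonal_comp {u} \<longleftrightarrow> x \<bullet> u = 0" for x u :: 'a
    by (simp add: orthogonal_comp_def orthogonal_def inner_commute)
  \<comment> \<open>If \<open>K2\<close> equals the orthogonal complement of \<open>u\<close>, the
    trivial intersection with \<open>K1\<close> turns this case into the second one.\<close>
  consider (hyperplane) u where "K2 \<subseteq> orthogonal_comp {u}" "orthogonal_comp {u} \<inter> K1 = {0}"
    | (finite_dim) V where "finite_dim_subspace V" "K1 \<subseteq> V \<or> K2 \<subseteq> V"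
    using abc inter by (metis Int_commute order_refl)
  then show thesis
  proof cases
    case hyperplane
    have meet: "x = 0" if "x \<in> K1" "x \<bullet> u = 0" for x
      using hyperplane(2) that perp by blast
    \<comment> \<open>For \<open>u = 0\<close> the complement is the whole space, which forces
      \<open>K1 = {0}\<close>, a subspace.\<close>
    have u: "u \<noteq> 0"
    proof
      assume "u = 0"
      then have "K1 = {0}"
        using meet K1(4) by auto
      then show False
        using K1(5) subspace_0 by (simp add: subspace_single_0)
    qed
    have K2u: "y \<bullet> u = 0" if "y \<in> K2" for y
      using hyperplane(1) that perp by blast
    have "(\<forall>x\<in>K1. x \<bullet> u \<le> 0) \<or> (\<forall>x\<in>K1. x \<bullet> u \<ge> 0)"
      using K1 meet by (intro cone_one_side_of_hyperplane)
    \<comment> \<open>As \<open>u\<close> vanishes on \<open>K2\<close>, either sign is admissible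
      there; the sign is dictated by \<open>K1\<close>.\<close>
    then show ?thesis
      using that[of u] that[of "- u"] u K2u by auto
  next
    case finite_dim
    then have "closed {a - b | a b. a \<in> K1 \<and> b \<in> K2}"
      using K1 K2 inter by (intro closed_cone_differences_finite_dim) auto
    then show ?thesis
      using separate_cones_closed_difference[of K1 K2] K1 K2 inter that by auto
  qed
qed

theorem corollary4p12:
  fixes K1 K2 :: "'a::{real_inner, complete_space} set"
  assumes nonzero_space: "\<exists>x::'a. x \<noteq> 0"
    and K1: "K1 \<noteq> {}" "closed K1" "convex K1" "strict_cone K1"
    and K2: "K2 \<noteq> {}" "closed K2" "convex K2" "strict_cone K2"
    and not_subspace: "\<not> subspace K1"
    and abc:
      "(\<exists>u. K2 = orthogonal_comp {u})
       \<or> (\<exists>u. K2 \<subseteq> orthogonal_comp {u} \<and> orthogonal_comp {u} \<inter> K1 = {0})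
       \<or> (\<exists>V. finite_dim_subspace V \<and> (K1 \<subseteq> V \<or> K2 \<subseteq> V))"
  shows
    "((K1 \<inter> K2 \<noteq> {0} \<longrightarrow> cos_min_angle K1 K2 = 1)
      \<and> (K1 \<inter> K2 = {0} \<longrightarrow>
           cos_min_angle (polar_cone K1) (dual_cone K2) = 1
           \<and> cos_min_angle (dual_cone K1) (polar_cone K2) = 1))
     \<and> (cos_min_angle K1 K2 < 1 \<longrightarrow>
          cos_min_angle (polar_cone K1) (dual_cone K2) = 1
          \<and> cos_min_angle (dual_cone K1) (polar_cone K2) = 1)"
proof -
  have zero: "0 \<in> K1" "0 \<in> K2"
    using closed_strict_cone_zero K1 K2 by auto
  have common: "cos_min_angle K1 K2 = 1" if ne: "K1 \<inter> K2 \<noteq> {0}"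
  proof -
    obtain w where "w \<in> K1" "w \<in> K2" "w \<noteq> 0"
      using ne zero by blast
    then show ?thesis
      using K1(4) K2(4) by (intro cos_min_angle_eq_1[of w] strict_cone_scale)
  qed
  have trivial: "cos_min_angle (polar_cone K1) (dual_cone K2) = 1
      \<and> cos_min_angle (dual_cone K1) (polar_cone K2) = 1" if triv: "K1 \<inter> K2 = {0}"
  proof -
    obtain w where "w \<noteq> 0" "\<And>x. x \<in> K1 \<Longrightarrow> x \<bullet> w \<le> 0" "\<And>y. y \<in> K2 \<Longrightarrow> y \<bullet> w \<ge> 0"
      using separating_vector_exists[OF K1(2-4) zero(1) not_subspace K2(2-4) zero(2) triv abc]
      by blast
    then show ?thesis
      using cos_min_angle_polar_dual by blast
  qed
  \<comment> \<open>For the last claim, \<open>common\<close> shows that a value below 1 forces the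
    intersection to be trivial, so \<open>trivial\<close> applies.\<close>
  show ?thesis
    using common trivial by force
qed

end
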